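(* Let $V$ be a Komori variety and let $A$ be an MV-algebra in $V$. Then the following conditions are equivalent: (i) $A$ is a local MV-algebra; (ii) $A$ is a model of $\mathbb{L}oc_V^2$.
   Context: An MV-algebra is a structure $(A,\oplus,\neg,0)$ such that $(A,\oplus,0)$ is a commutative monoid, $\neg\neg x=x$, $x\oplus\neg 0=\neg 0$ and $\neg(\neg x\oplus y)\oplus y=\neg(\neg y\oplus x)\oplus x$. Write $1=\neg 0$, $x\odot y=\neg(\neg x\oplus\neg y)$, $d(x,y)=(x\odot\neg y)\oplus(y\odot\neg x)$, $kx=x\oplus\cdots\oplus x$ and $x^k=x\odot\cdots\odot x$ ($k$ times). An MV-algebra is local if it is non-trivial and for every $x$ there is $k\ge 1$ with $kx=1$ or $k(\neg x)=1$. $\mathbb{MV}$ is the algebraic theory of MV-algebras. For a lattice-ordered abelian group $G$ and $u\ge 0$ in $G$, $\Gamma(G,u)$ is the MV-algebra on $[0,u]$ with $x\oplus y=\inf(x+y,u)$, $\neg x=u-x$. By Mundici's equivalence every MV-algebra is of this form with $u$ a strong unit. For $m\ge 1$, $S_m=\Gamma(\mathbb{Z},m)$ and $S_m^\omega=\Gamma(\mathbb{Z}\times_{\mathrm{lex}}\mathbb{Z},(m,0))$. A Komori variety is a variety $V=V(\{S_i\}_{i\in I},\{S_j^\omega\}_{j\in J})$ generated by these algebras, with $I,J$ finite sets of positive integers, not both empty. Put $n=\mathrm{l.c.m.}(I\cup J)$, which depends only on $V$. $\mathbb{T}_V$ denotes the algebraic theory axiomatizing $V$ (so its set-based models are exactly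 the algebras in $V$). Formulae $x\in\mathrm{Fin}_d^n$ ($0\le d\le n$). $x\in\mathrm{Fin}_0^n$ means $((n+1)x)^2=0$. For $1\le d\le n$ let $D=\gcd(d,n)$ and let $\xi,\chi$ be the unique natural numbers with $0\le\xi\le n/D$, $0\le\chi\le d/D$, $D=\xi d-\chi n$. Let $D_{d,n}^x$ be the MV-term in $x$ whose value in $\Gamma(G,u)$ is $\inf(u,\sup(0,\xi x-\chi u))$, computed in $G$; equivalently it is the $(\chi+1)$-th component of the sum of $\xi$ copies of the sequence $(x,0,0,\dots)$, where the sum $c$ of sequences $a,b$ is given by $c_i=a_i\oplus(a_{i-1}\odot b_1)\oplus\cdots\oplus(a_1\odot b_{i-1})\oplus b_i$. Write $z\equiv w$ for $((n+1)d(z,w))^2=0$. Then $x\in\mathrm{Fin}_d^n$ is the formula $(x\equiv\frac{d}{D}D_{d,n}^x)\wedge\bigwedge_{k=0}^{n/D}\big(\neg(kD_{d,n}^x)\equiv(\frac{n}{D}-k)D_{d,n}^x\big)$. $\mathbb{L}oc_V^2$ is obtained from $\mathbb{T}_V$ by adding $\rho_n:(\top\vdash_x\bigvee_{d=0}^n x\in\mathrm{Fin}_d^n)$ and $(0=1\vdash\bot)$. The axiom of choice is assumed. *)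

theory Defs
  imports
    "HOL-Library.Lattice_Algebras"
    "HOL-Library.Product_Lexorder"
    "HOL-Library.Product_Plus"
begin

section \<open>MV-algebras\<close>

record 'a mv =
  carrier :: "'a set"
  oplus :: "'a \<Rightarrow> 'a \<Rightarrow> 'a" (infixl "\<oplus>\<index>" 65)
  neg :: "'a \<Rightarrow> 'a" ("\<sim>\<index> _" [81] 80)
  zero :: 'a ("\<zero>\<index>")

locale mv_structure =
  fixes A :: "'a mv" (structure)
  assumes oplus_closed: "x \<in> carrier A \<Longrightarrow> y \<in> carrier A \<Longrightarrow> x \<oplus> y \<in> carrier A"
    and neg_closed: "x \<in> carrier A \<Longrightarrow> \<sim> x \<in> carrier A"
    and zero_closed: "\<zero> \<in> carrier A"

locale mv_algebra = mv_structure +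
  assumes oplus_assoc:
      "x \<in> carrier A \<Longrightarrow> y \<in> carrier A \<Longrightarrow> z \<in> carrier A \<Longrightarrow>
        (x \<oplus> y) \<oplus> z = x \<oplus> (y \<oplus> z)"
    and oplus_comm: "x \<in> carrier A \<Longrightarrow> y \<in> carrier A \<Longrightarrow> x \<oplus> y = y \<oplus> x"
    and oplus_zero: "x \<in> carrier A \<Longrightarrow> x \<oplus> \<zero> = x"
    and neg_neg: "x \<in> carrier A \<Longrightarrow> \<sim> (\<sim> x) = x"
    and oplus_neg_zero: "x \<in> carrier A \<Longrightarrow> x \<oplus> \<sim> \<zero> = \<sim> \<zero>"
    and lukasiewicz:
      "x \<in> carrier A \<Longrightarrow> y \<in> carrier A \<Longrightarrow>
        \<sim> (\<sim> x \<oplus> y) \<oplus> y = \<sim> (\<sim> y \<oplus> x) \<oplus> x"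

definition mv_one :: "'a mv \<Rightarrow> 'a" ("\<one>\<index>")
  where "mv_one A = \<sim>\<^bsub>A\<^esub> \<zero>\<^bsub>A\<^esub>"

primrec mv_mult :: "'a mv \<Rightarrow> nat \<Rightarrow> 'a \<Rightarrow> 'a"
  where
    "mv_mult A 0 x = \<zero>\<^bsub>A\<^esub>"
  | "mv_mult A (Suc k) x = mv_mult A k x \<oplus>\<^bsub>A\<^esub> x"

definition local_mv_algebra :: "'a mv \<Rightarrow> bool"
  where "local_mv_algebra A \<longleftrightarrow>
    mv_algebra A \<and>
    carrier A \<noteq> {\<zero>\<^bsub>A\<^esub>} \<and>
    (\<forall>x \<in> carrier A. \<exists>k\<ge>1.
      mv_mult A k x = \<one>\<^bsub>A\<^esub> \<or> mv_mult A k (\<sim>\<^bsub>A\<^esub> x) = \<one>\<^bsub>A\<^esub>)"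


section \<open>Mundici's functor on objects; the algebras generating Komori varieties\<close>

definition Gamma :: "'g::lattice_ab_group_add \<Rightarrow> 'g mv"
  where "Gamma u =
    \<lparr>carrier = {0..u}, oplus = (\<lambda>x y. inf (x + y) u), neg = (\<lambda>x. u - x), zero = 0\<rparr>"

lemma mv_algebra_Gamma:
  fixes u :: "'g::lattice_ab_group_add"
  assumes "0 \<le> u"
  shows "mv_algebra (Gamma u)"
proof -
  have 1: "inf (inf (x + y) u + z) u = inf (x + inf (y + z) u) u"
    if "0 \<le> x" "0 \<le> z" for x y z :: 'g
  proof -
    have "u \<le> u + z" "u \<le> x + u"
      using that by simp_all
    then have "inf (u + z) u = u" "inf (x + u) u = u"
      by (simp_all add: inf_absorb2)
    then show ?thesis
      by (simp add: add_inf_distrib_left add_inf_distrib_right inf_assoc add.assoc)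
  qed
  have 2: "inf (u - inf (u - x + y) u + y) u = sup x y"
    if "x \<le> u" "y \<le> u" for x y :: 'g
  proof -
    have "u - inf (u - x + y) u + y = sup x y"
      by (simp add: diff_inf_eq_sup add_sup_distrib_left add_sup_distrib_right)
    then show ?thesis
      using that by (simp add: inf_absorb1)
  qed
  show ?thesis
  proof (unfold_locales, goal_cases)
    case (4 x y z)
    then show ?case by (simp add: Gamma_def 1)
  next
    case (9 x y)
    then show ?case using 2[of x y] 2[of y x] by (simp add: Gamma_def sup.commute)
  qed (use assms in \<open>auto simp: Gamma_def inf_absorb1 inf_absorb2 add.commute\<close>)
qed

instance int :: lattice_ab_group_add ..

text \<open>
  From here on \<open>int \<times> int\<close>, with the order of \<open>Product_Lexorder\<close> and the addition of
  \<open>Product_Plus\<close>, is the lattice-ordered group usually written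
  \<open>\<int> \<times>\<^sub>l\<^sub>e\<^sub>x \<int>\<close>.
\<close>

instance prod :: (linordered_ab_group_add, linordered_ab_group_add) linordered_ab_group_add
  by standard (auto simp: less_eq_prod_def)

instance prod :: (linordered_ab_group_add, linordered_ab_group_add) lattice_ab_group_add ..

definition S :: "nat \<Rightarrow> int mv"
  where "S m = Gamma (int m)"

definition S_omega :: "nat \<Rightarrow> (int \<times> int) mv"
  where "S_omega m = Gamma (int m, 0)"


section \<open>Geometric theories over the signature of MV-algebras\<close>

datatype mv_term = Var nat | Zero | Neg mv_term | Oplus mv_term mv_term

primrec eval :: "'a mv \<Rightarrow> (nat \<Rightarrow> 'a) \<Rightarrow> mv_term \<Rightarrow> 'a"
  where
    "eval A v (Var i) = v i"
  | "eval A v Zero = \<zero>\<^bsub>A\<^esub>"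
  | "eval A v (Neg s) = \<sim>\<^bsub>A\<^esub> eval A v s"
  | "eval A v (Oplus s t) = eval A v s \<oplus>\<^bsub>A\<^esub> eval A v t"

text \<open>
  Quantifier-free formulae suffice for the theories considered here. Truth and falsity are
  \<open>Conj []\<close> and \<open>Disj []\<close>.
\<close>

datatype formula = Eq mv_term mv_term | Conj "formula list" | Disj "formula list"

fun sat :: "'a mv \<Rightarrow> (nat \<Rightarrow> 'a) \<Rightarrow> formula \<Rightarrow> bool"
  where
    "sat A v (Eq s t) \<longleftrightarrow> eval A v s = eval A v t"
  | "sat A v (Conj fs) \<longleftrightarrow> (\<forall>f \<in> set fs. sat A v f)"
  | "sat A v (Disj fs) \<longleftrightarrow> (\<exists>f \<in> set fs. sat A v f)"

datatype sequent = Sequent formula formula (infix "\<turnstile>" 50)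

text \<open>
  Contexts of variables need not be recorded in sequents: a structure has the element
  \<open>0\<close>, so irrelevant variables can always be assigned.
\<close>

primrec holds :: "'a mv \<Rightarrow> sequent \<Rightarrow> bool"
  where "holds A (f \<turnstile> g) \<longleftrightarrow>
    (\<forall>v. range v \<subseteq> carrier A \<longrightarrow> sat A v f \<longrightarrow> sat A v g)"

definition models :: "'a mv \<Rightarrow> sequent set \<Rightarrow> bool"
  where "models A T \<longleftrightarrow> mv_structure A \<and> (\<forall>\<sigma> \<in> T. holds A \<sigma>)"

definition identity :: "mv_term \<times> mv_term \<Rightarrow> sequent"
  where "identity e = (Conj [] \<turnstile> Eq (fst e) (snd e))"


section \<open>Komori varieties\<close>

text \<open>
  A variety is a class of MV-algebras defined by a set of identities. Hence an MV-algebra lies in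
  the variety generated by some algebras, that is, in the smallest variety containing them, if and
  only if it lies in each variety containing them.
\<close>

definition komori_variety :: "nat set \<Rightarrow> nat set \<Rightarrow> 'a mv set"
  where "komori_variety I J =
    {A. mv_algebra A \<and>
      (\<forall>E. (\<forall>i \<in> I. models (S i) (identity ` E)) \<and>
           (\<forall>j \<in> J. models (S_omega j) (identity ` E)) \<longrightarrow>
           models A (identity ` E))}"

definition T_V :: "nat set \<Rightarrow> nat set \<Rightarrow> sequent set"
  where "T_V I J =
    identity ` {e. (\<forall>i \<in> I. holds (S i) (identity e)) \<and>
                   (\<forall>j \<in> J. holds (S_omega j) (identity e))}"

lemma mv_algebra_S: "mv_algebra (S i)"
  by (simp add: S_def mv_algebra_Gamma)

lemma mv_algebra_S_omega: "mv_algebra (S_omega j)"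
  by (simp add: S_omega_def mv_algebra_Gamma zero_prod_def)

definition mv_axioms :: "(mv_term \<times> mv_term) set"
  where "mv_axioms =
    (let x = Var 0; y = Var 1; z = Var 2 in
     {(Oplus (Oplus x y) z, Oplus x (Oplus y z)),
      (Oplus x y, Oplus y x),
      (Oplus x Zero, x),
      (Neg (Neg x), x),
      (Oplus x (Neg Zero), Neg Zero),
      (Oplus (Neg (Oplus (Neg x) y)) y, Oplus (Neg (Oplus (Neg y) x)) x)})"

lemma mv_algebra_iff_models: "mv_algebra A \<longleftrightarrow> models A (identity ` mv_axioms)"
proof
  assume "mv_algebra A"
  then interpret mv_algebra A .
  show "models A (identity ` mv_axioms)"
    unfolding models_def mv_axioms_def identity_def Let_def
    using mv_structure_axioms
    by (auto simp: image_subset_iff oplus_assoc oplus_zero neg_neg oplus_neg_zero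
        intro: oplus_comm lukasiewicz)
next
  assume m: "models A (identity ` mv_axioms)"
  then interpret mv_structure A
    by (simp add: models_def)
  have *: "eval A (\<lambda>i. if i = 0 then x else if i = 1 then y else z) s =
      eval A (\<lambda>i. if i = 0 then x else if i = 1 then y else z) t"
    if st: "(s, t) \<in> mv_axioms" and xyz: "x \<in> carrier A" "y \<in> carrier A" "z \<in> carrier A"
    for s t x y z
  proof -
    have "holds A (identity (s, t))"
      using m st unfolding models_def by blast
    moreover have "range (\<lambda>i::nat. if i = 0 then x else if i = 1 then y else z) \<subseteq> carrier A"
      using xyz by auto
    ultimately show ?thesis
      unfolding identity_def holds.simps sat.simps fst_conv snd_conv by simp
  qed
  show "mv_algebra A"
  proof
    fix x y z
    assume "x \<in> carrier A" "y \<in> carrier A" "z \<in> carrier A"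
    note ** = *[OF _ this, unfolded mv_axioms_def Let_def]
    show "x \<oplus>\<^bsub>A\<^esub> y \<oplus>\<^bsub>A\<^esub> z = x \<oplus>\<^bsub>A\<^esub> (y \<oplus>\<^bsub>A\<^esub> z)"
      using **[of "Oplus (Oplus (Var 0) (Var 1)) (Var 2)"
          "Oplus (Var 0) (Oplus (Var 1) (Var 2))"] by simp
  next
    fix x y
    assume "x \<in> carrier A" "y \<in> carrier A"
    note ** = *[OF _ this zero_closed, unfolded mv_axioms_def Let_def]
    show "x \<oplus>\<^bsub>A\<^esub> y = y \<oplus>\<^bsub>A\<^esub> x"
      using **[of "Oplus (Var 0) (Var 1)" "Oplus (Var 1) (Var 0)"] by simp
    show "\<sim>\<^bsub>A\<^esub> (\<sim>\<^bsub>A\<^esub> x \<oplus>\<^bsub>A\<^esub> y) \<oplus>\<^bsub>A\<^esub> y =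
        \<sim>\<^bsub>A\<^esub> (\<sim>\<^bsub>A\<^esub> y \<oplus>\<^bsub>A\<^esub> x) \<oplus>\<^bsub>A\<^esub> x"
      using **[of "Oplus (Neg (Oplus (Neg (Var 0)) (Var 1))) (Var 1)"
          "Oplus (Neg (Oplus (Neg (Var 1)) (Var 0))) (Var 0)"] by simp
  next
    fix x
    assume "x \<in> carrier A"
    note ** = *[OF _ this zero_closed zero_closed, unfolded mv_axioms_def Let_def]
    show "x \<oplus>\<^bsub>A\<^esub> \<zero>\<^bsub>A\<^esub> = x"
      using **[of "Oplus (Var 0) Zero" "Var 0"] by simp
    show "\<sim>\<^bsub>A\<^esub> (\<sim>\<^bsub>A\<^esub> x) = x"
      using **[of "Neg (Neg (Var 0))" "Var 0"] by simp
    show "x \<oplus>\<^bsub>A\<^esub> \<sim>\<^bsub>A\<^esub> \<zero>\<^bsub>A\<^esub> = \<sim>\<^bsub>A\<^esub> \<zero>\<^bsub>A\<^esub>"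
      using **[of "Oplus (Var 0) (Neg Zero)" "Neg Zero"] by simp
  qed
qed

lemma models_T_V_iff: "models A (T_V I J) \<longleftrightarrow> A \<in> komori_variety I J"
proof -
  have s: "mv_structure (S i)" "mv_structure (S_omega i)" for i
    using mv_algebra_S[of i] mv_algebra_S_omega[of i] by (simp_all add: mv_algebra_def)
  have hold: "holds (S i) (identity e)" "holds (S_omega i) (identity e)"
    if "e \<in> mv_axioms" for e i
    using that mv_algebra_S[of i] mv_algebra_S_omega[of i]
    unfolding mv_algebra_iff_models models_def by blast+
  show ?thesis
  proof
    assume m: "models A (T_V I J)"
    have "models A (identity ` mv_axioms)"
      using m hold unfolding models_def T_V_def by blast
    then have "mv_algebra A"
      by (simp add: mv_algebra_iff_models)
    moreover have "models A (identity ` E)"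
      if "\<forall>i \<in> I. models (S i) (identity ` E)"
        and "\<forall>j \<in> J. models (S_omega j) (identity ` E)" for E
    proof -
      have "identity ` E \<subseteq> T_V I J"
        using that unfolding models_def T_V_def by blast
      with m show ?thesis
        unfolding models_def by blast
    qed
    ultimately show "A \<in> komori_variety I J"
      unfolding komori_variety_def by blast
  next
    assume "A \<in> komori_variety I J"
    then have *: "models A (identity ` E)"
      if "\<forall>i \<in> I. models (S i) (identity ` E)"
        and "\<forall>j \<in> J. models (S_omega j) (identity ` E)" for E
      using that unfolding komori_variety_def by blast
    show "models A (T_V I J)"
      unfolding T_V_def by (rule *) (auto simp: models_def s)
  qed
qed


section \<open>The formulae \<open>x \<in> Fin\<^sub>d\<^sup>n\<close> and the theory of local MV-algebras in a Komori variety\<close>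

definition One :: mv_term
  where "One = Neg Zero"

definition Odot :: "mv_term \<Rightarrow> mv_term \<Rightarrow> mv_term"
  where "Odot s t = Neg (Oplus (Neg s) (Neg t))"

definition Dist :: "mv_term \<Rightarrow> mv_term \<Rightarrow> mv_term"
  where "Dist s t = Oplus (Odot s (Neg t)) (Odot t (Neg s))"

primrec Mult :: "nat \<Rightarrow> mv_term \<Rightarrow> mv_term"
  where
    "Mult 0 t = Zero"
  | "Mult (Suc k) t = Oplus (Mult k t) t"

primrec Pow :: "mv_term \<Rightarrow> nat \<Rightarrow> mv_term"
  where
    "Pow t 0 = One"
  | "Pow t (Suc k) = Odot (Pow t k) t"

text \<open>
  Sequences of terms are indexed from \<open>1\<close>; the value at \<open>0\<close> is irrelevant.
\<close>

definition seq_sum :: "(nat \<Rightarrow> mv_term) \<Rightarrow> (nat \<Rightarrow> mv_term) \<Rightarrow> nat \<Rightarrow> mv_term"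
  where "seq_sum a b i =
    Oplus (foldl Oplus (a i) (map (\<lambda>j. Odot (a (i - j)) (b j)) [1..<i])) (b i)"

primrec seq_mult :: "nat \<Rightarrow> mv_term \<Rightarrow> nat \<Rightarrow> mv_term"
  where
    "seq_mult 0 t = (\<lambda>_. Zero)"
  | "seq_mult (Suc k) t = seq_sum (seq_mult k t) (\<lambda>i. if i = 1 then t else Zero)"

definition xi_chi :: "nat \<Rightarrow> nat \<Rightarrow> nat \<times> nat"
  where "xi_chi d n =
    (THE (\<xi>, \<chi>). \<xi> \<le> n div gcd d n \<and> \<chi> \<le> d div gcd d n \<and>
      int (gcd d n) = int \<xi> * int d - int \<chi> * int n)"

definition D_term :: "nat \<Rightarrow> nat \<Rightarrow> mv_term \<Rightarrow> mv_term"
  where "D_term d n x = (case xi_chi d n of (\<xi>, \<chi>) \<Rightarrow> seq_mult \<xi> x (\<chi> + 1))"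

definition Equiv :: "nat \<Rightarrow> mv_term \<Rightarrow> mv_term \<Rightarrow> formula"
  where "Equiv n s t = Eq (Pow (Mult (n + 1) (Dist s t)) 2) Zero"

definition Fin :: "nat \<Rightarrow> nat \<Rightarrow> mv_term \<Rightarrow> formula"
  where "Fin n d x =
    (if d = 0 then Eq (Pow (Mult (n + 1) x) 2) Zero
     else let D = gcd d n; t = D_term d n x in
       Conj (Equiv n x (Mult (d div D) t) #
         map (\<lambda>k. Equiv n (Neg (Mult k t)) (Mult (n div D - k) t)) [0..<n div D + 1]))"

definition rho :: "nat \<Rightarrow> sequent"
  where "rho n = (Conj [] \<turnstile> Disj (map (\<lambda>d. Fin n d (Var 0)) [0..<n + 1]))"

definition Loc2 :: "nat set \<Rightarrow> nat set \<Rightarrow> sequent set"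
  where "Loc2 I J = T_V I J \<union> {rho (Lcm (I \<union> J)), Eq Zero One \<turnstile> Disj []}"

end

theory Submission
  imports Defs
begin

text \<open>
  The variety enters only through identities, so everything can be checked on the generators, and
  there everything reduces to finite chains of integers.

  In a generator \<open>G = \<Gamma>(H, u)\<close> let the rank of an element be its image in \<open>\<int>\<close>: itself
  for \<open>S\<^sub>m\<close>, the first coordinate for \<open>S\<^sub>m\<^sup>\<omega>\<close>; the elements of rank \<open>0\<close> are the
  infinitesimals. As \<open>m\<close> divides \<open>n\<close>, an element of positive rank has multiple
  \<open>n + 1\<close> equal to \<open>1\<close>, so the term \<open>((n + 1)x)\<^sup>2\<close> takes only the values \<open>0\<close> and \<open>1\<close> on
  \<open>G\<close>, and is \<open>0\<close> exactly on the infinitesimals (lemma \<open>eval_appreciable\<close>). Two consequences follow.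

  First, a formula built by conjunction and disjunction from equations \<open>((n + 1)s)\<^sup>2 = 0\<close>, such as
  \<open>x \<in> Fin\<^sub>d\<^sup>n\<close>, depends only on ranks (\<open>sat_rank\<close>). Since the rank is a homomorphism onto \<open>S\<^sub>m\<close>, in
  which \<open>\<equiv>\<close> is equality, an integer computation shows that some \<open>x \<in> Fin\<^sub>d\<^sup>n\<close> always holds,
  with \<open>d = n rank(x) / m\<close> (\<open>sat_S_Fin\<close>), and that \<open>x \<in> Fin\<^sub>d\<^sup>n\<close> with \<open>d > 0\<close> forces
  positive rank, while \<open>d = 0\<close> forces rank \<open>0\<close> (\<open>sat_S_Fin_rank\<close>).

  Secondly, such a formula is encoded by a term, its defect: replace each equation by its left-hand
  side, conjunction by \<open>\<oplus>\<close> and disjunction by \<open>\<odot>\<close>. Where \<open>((n + 1)x)\<^sup>2\<close> takes only the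
  values \<open>0\<close> and \<open>1\<close>, the formula is equivalent to the vanishing of its defect
  (\<open>defect_eq\<close>). Statements about the formulae thus become identities, true in the
  generators and hence in every algebra \<open>A\<close> of the variety (\<open>coarse_identities_hold\<close>).

  If \<open>A\<close> is local, its only idempotents are \<open>0\<close> and \<open>1\<close>. That \<open>((n + 1)x)\<^sup>2\<close> and its negation are
  idempotent is an identity of the generators, so this term is two-valued on \<open>A\<close> too. That the defect of
  the disjunction of all the \<open>x \<in> Fin\<^sub>d\<^sup>n\<close> is \<open>0\<close> is another identity, and on \<open>A\<close> it
  now says that this disjunction holds. Conversely, for \<open>d > 0\<close> the generators satisfy the
  identity that the defect of \<open>x \<in> Fin\<^sub>d\<^sup>n\<close> plus \<open>(n + 1)x\<close> is \<open>1\<close>, and for \<open>d = 0\<close>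
  the same with \<open>(n + 1)(\<not>x)\<close>. So if \<open>A\<close> satisfies \<open>\<rho>\<^sub>n\<close>, then for each \<open>x\<close> one of
  \<open>(n + 1)x\<close>, \<open>(n + 1)(\<not>x)\<close> is \<open>1\<close>.
\<close>

section \<open>Evaluation of terms\<close>

lemma (in mv_structure) eval_closed:
  assumes "range v \<subseteq> carrier A"
  shows "eval A v t \<in> carrier A"
  using assms by (induction t) (auto simp: oplus_closed neg_closed zero_closed)

lemma eval_Mult: "eval A v (Mult k t) = mv_mult A k (eval A v t)"
  by (induction k) simp_all

lemma eval_One: "eval A v One = \<one>\<^bsub>A\<^esub>"
  by (simp add: One_def mv_one_def)

lemma eval_Odot:
  "eval A v (Odot s t) = \<sim>\<^bsub>A\<^esub> (\<sim>\<^bsub>A\<^esub> eval A v s \<oplus>\<^bsub>A\<^esub> \<sim>\<^bsub>A\<^esub> eval A v t)"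
  by (simp add: Odot_def)

context mv_algebra
begin

lemma one_closed: "\<one> \<in> carrier A"
  by (simp add: mv_one_def neg_closed zero_closed)

lemma neg_one: "\<sim> \<one> = \<zero>"
  by (simp add: mv_one_def neg_neg zero_closed)

lemma oplus_one:
  assumes "x \<in> carrier A"
  shows "x \<oplus> \<one> = \<one>" "\<one> \<oplus> x = \<one>"
  using assms oplus_neg_zero oplus_comm one_closed by (simp_all add: mv_one_def)

lemma zero_oplus: "x \<in> carrier A \<Longrightarrow> \<zero> \<oplus> x = x"
  using oplus_comm oplus_zero zero_closed by metis

lemma mv_mult_idem:
  assumes "b \<in> carrier A" "b \<oplus> b = b"
  shows "mv_mult A (Suc k) b = b"
  using assms by (induction k) (simp_all add: zero_oplus)

end


section \<open>Coarse formulae and their defects\<close>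

text \<open>
  The name is that of nonstandard analysis: in the generators this term is \<open>0\<close> on infinitesimal
  elements and \<open>1\<close> on all others.
\<close>

definition appreciable :: "nat \<Rightarrow> mv_term \<Rightarrow> mv_term"
  where "appreciable n s = Pow (Mult (n + 1) s) 2"

text \<open>
  In the generators, coarse formulae cannot distinguish elements at infinitesimal distance.
\<close>

inductive coarse :: "nat \<Rightarrow> formula \<Rightarrow> bool" for n
  where
    coarse_Eq: "coarse n (Eq (appreciable n s) Zero)"
  | coarse_Conj: "(\<And>f. f \<in> set fs \<Longrightarrow> coarse n f) \<Longrightarrow> coarse n (Conj fs)"
  | coarse_Disj: "(\<And>f. f \<in> set fs \<Longrightarrow> coarse n f) \<Longrightarrow> coarse n (Disj fs)"

text \<open>
  Only equations with right-hand side \<open>Zero\<close> occur in coarse formulae, so the first clause can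
  discard the right-hand side.
\<close>

fun defect :: "formula \<Rightarrow> mv_term"
  where
    "defect (Eq s t) = s"
  | "defect (Conj fs) = foldr (\<lambda>f t. Oplus (defect f) t) fs Zero"
  | "defect (Disj fs) = foldr (\<lambda>f t. Odot (defect f) t) fs One"

lemma coarse_Equiv: "coarse n (Equiv n s t)"
  using coarse_Eq[of n "Dist s t"] by (simp add: Equiv_def appreciable_def)

lemma coarse_Fin: "coarse n (Fin n d t)"
  using coarse_Eq[of n t]
  by (auto simp: Fin_def Let_def appreciable_def intro!: coarse_Conj coarse_Equiv)

lemma coarse_Fins: "coarse n (Disj (map (\<lambda>d. Fin n d t) ds))"
  by (auto intro!: coarse_Disj coarse_Fin)

text \<open>
  Sums of zeros vanish, and so does a product with a vanishing factor. Unlike its converse, this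
  half of the correspondence between a formula and its defect is thus available in algebras not
  yet known to be local.
\<close>

lemma (in mv_algebra) defect_eq_zero:
  assumes "coarse n f" and "range v \<subseteq> carrier A" and "sat A v f"
  shows "eval A v (defect f) = \<zero>"
  using assms(1,3)
proof (induction rule: coarse.induct)
  case (coarse_Conj fs)
  then show ?case
    by (induction fs) (simp_all add: oplus_zero zero_closed)
next
  case (coarse_Disj fs)
  have mem: "eval A v t \<in> carrier A" for t
    using assms(2) by (rule eval_closed)
  from coarse_Disj show ?case
  proof (induction fs)
    case (Cons f fs)
    let ?p = "eval A v (defect f)" and ?q = "eval A v (defect (Disj fs))"
    have "?p = \<zero> \<or> ?q = \<zero>"
      using Cons by (cases "sat A v f") simp_all
    then show ?case
      using mem[of "defect f"] mem[of "defect (Disj fs)"]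
      by (auto simp: eval_Odot mv_one_def[symmetric] oplus_one neg_one neg_closed)
  qed simp
qed simp

text \<open>
  Generators and local algebras of the variety share this property, so the correspondence between
  formulae and defects is proved once for both.
\<close>

locale two_valued = mv_algebra +
  fixes n :: nat
  assumes nontrivial: "\<zero> \<noteq> \<one>"
    and appreciable_cases: "\<And>v s. range v \<subseteq> carrier A \<Longrightarrow>
      eval A v (appreciable n s) = \<zero> \<or> eval A v (appreciable n s) = \<one>"
begin

lemma defect_eq:
  assumes "coarse n f" and v: "range v \<subseteq> carrier A"
  shows "eval A v (defect f) = (if sat A v f then \<zero> else \<one>)"
  using assms(1)
proof (induction rule: coarse.induct)
  case (coarse_Eq s)
  then show ?case
    using appreciable_cases[OF v, of s] nontrivial by auto
next
  case (coarse_Conj fs)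
  then show ?case
    by (induction fs) (simp_all add: oplus_zero oplus_one zero_oplus zero_closed one_closed)
next
  case (coarse_Disj fs)
  then show ?case
    by (induction fs)
      (simp_all add: eval_One eval_Odot mv_one_def[symmetric] neg_one oplus_zero oplus_one
        zero_oplus zero_closed one_closed)
qed

end


section \<open>Generators of Komori varieties\<close>

lemma Gamma_simps [simp]:
  "carrier (Gamma u) = {0..u}" "x \<oplus>\<^bsub>Gamma u\<^esub> y = inf (x + y) u"
  "\<sim>\<^bsub>Gamma u\<^esub> x = u - x" "\<zero>\<^bsub>Gamma u\<^esub> = 0" "\<one>\<^bsub>Gamma u\<^esub> = u"
  by (simp_all add: Gamma_def mv_one_def)

text \<open>
  The common structure of \<open>\<int>\<close> with the identity and of \<open>\<int> \<times>\<^sub>l\<^sub>e\<^sub>x \<int>\<close> with the first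
  projection: a homomorphism of linearly ordered groups to \<open>\<int>\<close>, whose kernel consists of the
  infinitesimals.
\<close>

locale ranked_group =
  fixes u :: "'g::{lattice_ab_group_add,linorder}" and rank :: "'g \<Rightarrow> int" and m :: nat
  assumes rank_add: "rank (x + y) = rank x + rank y"
    and rank_mono: "x \<le> y \<Longrightarrow> rank x \<le> rank y"
    and rank_unit: "rank u = int m"
    and unit_ge_zero: "0 \<le> u"
    and m_pos: "m \<ge> 1"
begin

sublocale G: mv_algebra "Gamma u"
  using unit_ge_zero by (rule mv_algebra_Gamma)

lemma rank_zero: "rank 0 = 0"
  using rank_add[of 0 0] by simp

lemma rank_diff: "rank (x - y) = rank x - rank y"
  using rank_add[of "x - y" y] by simp

lemma rank_inf: "rank (inf x y) = inf (rank x) (rank y)"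
  using rank_mono[of x y] rank_mono[of y x] by (cases "x \<le> y") (auto simp: inf_absorb1 inf_absorb2)

lemma rank_range: "x \<in> {0..u} \<Longrightarrow> rank x \<in> {0..int m}"
  using rank_mono[of 0 x] rank_mono[of x u] by (simp add: rank_zero rank_unit)

lemma rank_less: "rank x < rank y \<Longrightarrow> x \<le> y"
  using rank_mono[of y x] by force

text \<open>
  The rank induces an MV-homomorphism to the finite chain, so all terms can be evaluated there.
\<close>

lemma eval_rank: "eval (S m) (rank \<circ> v) t = rank (eval (Gamma u) v t)"
  by (induction t)
    (simp_all add: S_def rank_add rank_diff rank_inf rank_zero rank_unit)

lemma rank_mult_lower:
  assumes "rank x \<ge> 1"
  shows "rank (mv_mult (Gamma u) k x) \<ge> min (int m) (int k)"
  using assms by (induction k)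
    (auto simp: rank_zero rank_inf rank_add rank_unit inf_min min_def split: if_splits)

lemma rank_mult_infinitesimal:
  assumes "rank x = 0"
  shows "rank (mv_mult (Gamma u) k x) = 0"
  using assms by (induction k) (simp_all add: rank_zero rank_inf rank_add rank_unit inf_absorb1)

text \<open>
  The \<open>n\<close>-th multiple already has full rank, but may fall short of \<open>u\<close> by an infinitesimal; one
  further summand of positive rank closes the gap.
\<close>

lemma mult_eq_one:
  assumes "x \<in> {0..u}" "rank x \<noteq> 0" "m \<le> n"
  shows "mv_mult (Gamma u) (n + 1) x = u"
proof -
  have "rank x \<ge> 1"
    using rank_range[OF assms(1)] assms(2) by simp
  then have "rank u < rank (mv_mult (Gamma u) n x + x)"
    using rank_mult_lower[of x n] assms(3) by (simp add: rank_add rank_unit)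
  then show ?thesis
    using rank_less by (simp add: inf_absorb2)
qed

text \<open>
  If \<open>x\<close> is infinitesimal, so is \<open>y = (n + 1)x\<close>; then \<open>\<not>y\<close> has full rank \<open>m > 0\<close>,
  hence \<open>\<not>y \<oplus> \<not>y = 1\<close> and \<open>y \<odot> y = 0\<close>. Otherwise \<open>y = 1\<close>.
\<close>

lemma eval_appreciable:
  assumes v: "range v \<subseteq> {0..u}" and "m \<le> n"
  shows "eval (Gamma u) v (appreciable n s) = (if rank (eval (Gamma u) v s) = 0 then 0 else u)"
proof -
  let ?x = "eval (Gamma u) v s"
  let ?y = "mv_mult (Gamma u) (n + 1) ?x"
  have mem: "?x \<in> {0..u}" "?y \<in> {0..u}"
    using v G.eval_closed[of v s] G.eval_closed[of v "Mult (n + 1) s"]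
    by (simp_all add: eval_Mult del: mv_mult.simps Mult.simps)
  have sq: "eval (Gamma u) v (appreciable n s) = u - inf (u - ?y + (u - ?y)) u"
    using mem(2) unit_ge_zero
    by (simp add: appreciable_def numeral_2_eq_2 eval_Odot eval_One eval_Mult inf_absorb1
        del: mv_mult.simps Mult.simps)
  show ?thesis
  proof (cases "rank ?x = 0")
    case True
    then have "rank (u - ?y) = int m"
      using rank_mult_infinitesimal[of ?x "n + 1"] by (simp only: rank_diff rank_unit diff_zero)
    then have "rank u < rank (u - ?y + (u - ?y))"
      using m_pos by (simp only: rank_add rank_unit)
    from rank_less[OF this] True sq show ?thesis
      by (simp add: inf_absorb2 del: mv_mult.simps)
  next
    case False
    with sq show ?thesis
      unfolding mult_eq_one[OF mem(1) False assms(2)]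
      using unit_ge_zero by (simp add: inf_absorb1)
  qed
qed

lemma two_valued_Gamma:
  assumes "m \<le> n"
  shows "two_valued (Gamma u) n"
proof
  show "\<zero>\<^bsub>Gamma u\<^esub> \<noteq> \<one>\<^bsub>Gamma u\<^esub>"
    using rank_unit rank_zero m_pos by auto
qed (use eval_appreciable[OF _ assms] in auto)

end

lemma ranked_group_int: "m \<ge> 1 \<Longrightarrow> ranked_group (int m) (\<lambda>x. x) m"
  by unfold_locales auto

lemma ranked_group_lex: "m \<ge> 1 \<Longrightarrow> ranked_group (int m, 0) fst m"
  by unfold_locales (auto simp: zero_prod_def)

lemma (in ranked_group) sat_rank:
  assumes "coarse n f" and v: "range v \<subseteq> {0..u}" and "m \<le> n"
  shows "sat (Gamma u) v f \<longleftrightarrow> sat (S m) (rank \<circ> v) f"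
  using assms(1)
proof (induction rule: coarse.induct)
  case (coarse_Eq s)
  interpret Z: ranked_group "int m" "\<lambda>x. x" m
    using m_pos by (rule ranked_group_int)
  have "range (rank \<circ> v) \<subseteq> {0..int m}"
    using v rank_range by fastforce
  from Z.eval_appreciable[OF this assms(3), of s] eval_appreciable[OF v assms(3), of s]
    eval_rank[of v s]
  have "eval (Gamma u) v (appreciable n s) = 0 \<longleftrightarrow> eval (S m) (rank \<circ> v) (appreciable n s) = 0"
    using rank_unit rank_zero m_pos unfolding S_def by (cases "u = 0") auto
  then show ?case
    by (simp only: sat.simps eval.simps Gamma_simps S_def)
qed simp_all


section \<open>The formulae Fin in finite chains\<close>

lemma S_simps [simp]:
  "carrier (S m) = {0..int m}" "x \<oplus>\<^bsub>S m\<^esub> y = min (x + y) (int m)"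
  "\<sim>\<^bsub>S m\<^esub> x = int m - x" "\<zero>\<^bsub>S m\<^esub> = 0" "\<one>\<^bsub>S m\<^esub> = int m"
  by (simp_all add: S_def inf_min)

lemma mv_mult_S:
  assumes "0 \<le> x"
  shows "mv_mult (S m) k x = min (int k * x) (int m)"
  using assms by (induction k) (auto simp: algebra_simps min_def)

lemma eval_S_range: "range v \<subseteq> {0..int m} \<Longrightarrow> eval (S m) v t \<in> {0..int m}"
  using mv_algebra_S[of m] mv_structure.eval_closed[of "S m" v t] by (simp add: mv_algebra_def)

lemma sat_S_appreciable:
  assumes "m \<ge> 1" "m \<le> n" "range v \<subseteq> {0..int m}"
  shows "sat (S m) v (Eq (appreciable n s) Zero) \<longleftrightarrow> eval (S m) v s = 0"
  using ranked_group.eval_appreciable[OF ranked_group_int assms(3,2)] assms(1)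
  by (simp add: S_def)

lemma sat_S_Equiv:
  assumes "m \<ge> 1" "m \<le> n" "range v \<subseteq> {0..int m}"
  shows "sat (S m) v (Equiv n s t) \<longleftrightarrow> eval (S m) v s = eval (S m) v t"
  using sat_S_appreciable[OF assms, of "Dist s t"]
    eval_S_range[OF assms(3), of s] eval_S_range[OF assms(3), of t]
  by (auto simp: Equiv_def appreciable_def Dist_def eval_Odot simp del: sat.simps)

text \<open>
  For \<open>d > 0\<close> the conjunct with \<open>k = 0\<close> says that a multiple of the term \<open>D_term d n s\<close> is
  \<open>1\<close>, so this term is not \<open>0\<close>; and the first conjunct makes \<open>s\<close> a positive multiple of it.
\<close>

lemma sat_S_Fin_rank:
  assumes "m \<ge> 1" "m \<le> n" "range v \<subseteq> {0..int m}" "sat (S m) v (Fin n d s)"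
  shows "eval (S m) v s = 0 \<longleftrightarrow> d = 0"
proof (cases "d = 0")
  case True
  with assms(4) sat_S_appreciable[OF assms(1-3), of s] show ?thesis
    by (simp add: Fin_def appreciable_def del: sat.simps)
next
  case False
  let ?D = "gcd d n"
  define t where "t = D_term d n s"
  have "sat (S m) v (Equiv n s (Mult (d div ?D) t))"
    and "\<forall>k \<in> set [0..<n div ?D + 1]. sat (S m) v (Equiv n (Neg (Mult k t)) (Mult (n div ?D - k) t))"
    using assms(4) False
    by (simp_all add: Fin_def Let_def t_def del: upt.simps set_upt Mult.simps)
  moreover have "0 \<in> set [0..<n div ?D + 1]"
    unfolding set_upt by simp
  ultimately have "sat (S m) v (Equiv n s (Mult (d div ?D) t))"
    and "sat (S m) v (Equiv n (Neg (Mult 0 t)) (Mult (n div ?D - 0) t))"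
    by blast+
  then have eq: "eval (S m) v s = mv_mult (S m) (d div ?D) (eval (S m) v t)"
    "int m = mv_mult (S m) (n div ?D) (eval (S m) v t)"
    by (simp_all add: sat_S_Equiv[OF assms(1-3)] eval_Mult del: Mult.simps(2))
  have t0: "0 \<le> eval (S m) v t"
    using eval_S_range[OF assms(3), of t] by simp
  have "eval (S m) v t \<noteq> 0"
    using eq(2) assms(1) by (auto simp: mv_mult_S)
  moreover have "d div ?D \<noteq> 0"
    using False by (simp add: dvd_div_eq_0_iff)
  ultimately show ?thesis
    using False t0 assms(1) by (simp add: eq(1) mv_mult_S min_def)
qed

text \<open>
  The sequence cuts the integer \<open>k x\<close> into blocks of length \<open>m\<close>; its \<open>i\<close>-th component is the part
  of \<open>k x\<close> lying in the \<open>i\<close>-th block.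
\<close>

lemma eval_seq_mult:
  assumes v: "range v \<subseteq> {0..int m}" and "i \<ge> 1"
  shows "eval (S m) v (seq_mult k t i) =
    min (int m) (max 0 (int k * eval (S m) v t - (int i - 1) * int m))"
  using \<open>i \<ge> 1\<close>
proof (induction k arbitrary: i)
  case 0
  then have "0 \<le> (int i - 1) * int m" by simp
  then show ?case by simp
next
  case (Suc k)
  let ?e = "eval (S m) v" and ?a = "seq_mult k t"
  let ?b = "\<lambda>i. if i = 1 then t else Zero"
  have x: "0 \<le> ?e t" "?e t \<le> int m"
    using eval_S_range[OF v, of t] by simp_all
  have range_e: "0 \<le> ?e s" "?e s \<le> int m" for s
    using eval_S_range[OF v, of s] by simp_all
  \<comment> \<open>Only the product with index 1 contributes to the convolution.\<close>
  have zeros: "?e (foldl Oplus s (map (\<lambda>j. Odot (?a (i - j)) (?b j)) js)) = ?e s"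
    if "\<forall>j \<in> set js. j \<noteq> 1" for s js
    using that
  proof (induction js arbitrary: s)
    case (Cons j js)
    then show ?case
      using range_e[of "?a (i - j)"] range_e[of s] by (simp add: eval_Odot)
  qed simp
  show ?case
  proof (cases "i = 1")
    case True
    then have "?e (seq_mult (Suc k) t i) = min (?e (?a 1) + ?e t) (int m)"
      by (simp add: seq_sum_def)
    also have "\<dots> = min (int m) (int k * ?e t + ?e t)"
      using Suc.IH[of 1] x by simp
    finally show ?thesis
      using True x by (simp add: algebra_simps)
  next
    case False
    with Suc.prems have i: "i \<ge> 2" by simp
    then have upt: "[Suc 0..<i] = Suc 0 # [2..<i]"
      by (simp add: upt_conv_Cons numeral_2_eq_2)
    define P where "P = int k * ?e t"
    define Q where "Q = (int i - 2) * int m"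
    have PQ: "int (Suc k) * ?e t = P + ?e t" "(int i - 1) * int m = Q + int m"
      "(int (i - 1) - 1) * int m = Q" "0 \<le> Q"
      using i by (simp add: P_def algebra_simps, simp add: Q_def algebra_simps, simp_all add: Q_def)
    have IH: "?e (?a i) = min (int m) (max 0 (P - (Q + int m)))"
      "?e (?a (i - 1)) = min (int m) (max 0 (P - Q))"
      using Suc.IH[of i] Suc.IH[of "i - 1"] i unfolding P_def[symmetric] PQ by simp_all
    have "?e (seq_mult (Suc k) t i) =
      min (?e (Oplus (?a i) (Odot (?a (i - 1)) t))) (int m)"
      using False zeros[of "[2..<i]" "Oplus (?a i) (Odot (?a (i - 1)) t)"]
      by (simp add: seq_sum_def upt)
    also have "\<dots> = min (int m) (max 0 (P + ?e t - (Q + int m)))"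
      using x by (simp add: eval_Odot IH[unfolded One_nat_def]) linarith
    finally show ?thesis
      unfolding PQ .
  qed
qed

text \<open>
  The pairs solving \<open>x a - y b = 1\<close> differ by multiples of \<open>(b, a)\<close>, so \<open>x\<close> can be chosen as a
  representative modulo \<open>b\<close> between \<open>1\<close> and \<open>b\<close>, and \<open>y\<close> is then bounded accordingly.
\<close>

lemma bezout_bounded:
  fixes a b :: int
  assumes "a \<ge> 1" "b \<ge> 1" "coprime a b"
  shows "\<exists>x y. 0 \<le> x \<and> x \<le> b \<and> 0 \<le> y \<and> y \<le> a \<and> x * a - y * b = 1"
proof -
  obtain u v where uv: "u * a + v * b = 1"
    using bezout_int[of a b] assms(3) by auto
  define q where "q = (u - 1) div b"
  define x where "x = (u - 1) mod b + 1"
  define y where "y = - v - q * a"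
  have x: "1 \<le> x" "x \<le> b" "x = u - q * b"
    using assms(2) pos_mod_bound[of b "u - 1"] pos_mod_sign[of b "u - 1"]
      minus_div_mult_eq_mod[of "u - 1" b]
    unfolding x_def q_def by linarith+
  have eq: "x * a - y * b = 1"
    using uv by (simp add: x(3) y_def algebra_simps)
  have "1 * 1 \<le> x * a"
    using assms(1) x(1) by (intro mult_mono) auto
  then have "0 \<le> y * b"
    using eq by linarith
  moreover have "x * a \<le> b * a"
    using assms(1) x(2) by (intro mult_right_mono) auto
  then have "y * b \<le> a * b"
    using eq by (simp add: mult.commute)
  ultimately have "0 \<le> y" "y \<le> a"
    using assms(2) by (simp_all add: zero_le_mult_iff)
  then show ?thesis
    using x(1,2) eq by (intro exI[of _ x] exI[of _ y]) simp
qed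

text \<open>
  The interval from \<open>0\<close> to \<open>b\<close> has both end points congruent modulo \<open>b\<close>, but \<open>x = 0\<close> is
  impossible because \<open>- y b\<close> is not positive.
\<close>

lemma bezout_bounded_unique:
  fixes a b :: int
  assumes "b \<ge> 1" "coprime a b"
    and "0 \<le> x" "x \<le> b" "0 \<le> y" "x * a - y * b = 1"
    and "0 \<le> x'" "x' \<le> b" "0 \<le> y'" "x' * a - y' * b = 1"
  shows "x = x'" "y = y'"
proof -
  have "(x - x') * a = (y - y') * b"
    using assms(6,10) by (simp add: algebra_simps)
  then have "b dvd x - x'"
    using assms(2) by (metis coprime_commute coprime_dvd_mult_left_iff dvd_triv_right)
  moreover have "0 \<le> y * b" "0 \<le> y' * b"
    using assms by simp_all
  then have "x \<noteq> 0" "x' \<noteq> 0"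
    using assms(6,10) by auto
  then have "\<bar>x - x'\<bar> < b"
    using assms by linarith
  ultimately show "x = x'"
    using zdvd_not_zless[of "\<bar>x - x'\<bar>" b] by auto
  with assms(6,10) have "y * b = y' * b"
    by (metis diff_left_imp_eq)
  then show "y = y'"
    using assms(1) by simp
qed

text \<open>
  Dividing by \<open>gcd d n\<close> reduces the defining equation of \<open>\<xi>\<close> and \<open>\<chi>\<close> to the coprime case;
  unique solvability there makes the definite description meaningful.
\<close>

lemma xi_chi_spec:
  assumes "n \<ge> 1" "d \<ge> 1"
  obtains \<xi> \<chi> where "xi_chi d n = (\<xi>, \<chi>)" "int (gcd d n) = int \<xi> * int d - int \<chi> * int n"
proof -
  define D where "D = gcd d n"
  obtain a b where ab: "d = a * D" "n = b * D" "coprime a b"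
    using gcd_coprime_exists[of d n] assms unfolding D_def by (metis gcd_eq_0_iff not_one_le_zero)
  have D: "D > 0" using assms by (simp add: D_def)
  have quot: "d div D = a" "n div D = b"
    using ab(1,2) D by (metis nonzero_mult_div_cancel_right less_numeral_extra(3))+
  have pos: "int a \<ge> 1" "int b \<ge> 1"
    using ab(1,2) assms by (auto simp: Suc_le_eq intro!: Nat.gr0I)
  have cop: "coprime (int a) (int b)" using ab(3) by simp
  have scale: "int D = int x * int d - int y * int n \<longleftrightarrow> int x * int a - int y * int b = 1" for x y
  proof -
    have "int x * int d - int y * int n = int D * (int x * int a - int y * int b)"
      using ab(1,2) by (simp add: algebra_simps)
    then show ?thesis using D by auto
  qed
  let ?P = "\<lambda>x y. x \<le> b \<and> y \<le> a \<and> int D = int x * int d - int y * int n"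
  obtain x y :: int where xy: "0 \<le> x" "x \<le> int b" "0 \<le> y" "y \<le> int a" "x * int a - y * int b = 1"
    using bezout_bounded[OF pos cop] by blast
  then have P: "?P (nat x) (nat y)"
    by (simp only: scale) (simp add: nat_le_iff)
  have "xi_chi d n = (THE (x, y). ?P x y)"
    by (simp only: xi_chi_def D_def[symmetric] quot)
  also have "\<dots> = (nat x, nat y)"
  proof (rule the_equality)
    show "case (nat x, nat y) of (x, y) \<Rightarrow> ?P x y" using P by simp
  next
    fix z assume "case z of (x, y) \<Rightarrow> ?P x y"
    then obtain x' y' where z: "z = (x', y')" "?P x' y'" by (cases z) auto
    then have "int x' * int a - int y' * int b = 1" by (simp only: scale)
    from bezout_bounded_unique[OF pos(2) cop xy(1-3,5) _ _ _ this] z show "z = (nat x, nat y)"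
      by auto
  qed
  finally show ?thesis using that P by (auto simp: D_def)
qed

text \<open>
  The hypothesis says that \<open>s\<close> has the value \<open>d m / n\<close>. With \<open>D = gcd d n\<close>, the term
  \<open>D_term d n s\<close> then has the value \<open>q = \<xi> d m / n - \<chi> m = D m / n\<close>, of which \<open>m\<close> is the
  multiple by \<open>n / D\<close> and the value of \<open>s\<close> the multiple by \<open>d / D\<close>.
\<close>

lemma sat_S_Fin:
  assumes "m dvd n" "n \<ge> 1" and v: "range v \<subseteq> {0..int m}"
    and d: "int d * int m = eval (S m) v s * int n"
  shows "sat (S m) v (Fin n d s)"
proof -
  have m: "m \<ge> 1" "m \<le> n"
    using assms(1,2) by (auto simp: Suc_le_eq dvd_imp_le intro: Nat.gr0I)
  show ?thesis
  proof (cases "d = 0")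
    case True
    with d assms(2) have "eval (S m) v s = 0" by simp
    with True show ?thesis
      using sat_S_appreciable[OF m v] by (simp add: Fin_def appreciable_def del: sat.simps)
  next
    case False
    let ?x = "eval (S m) v s"
    define D where "D = gcd d n"
    obtain \<xi> \<chi> where xc: "xi_chi d n = (\<xi>, \<chi>)" "int D = int \<xi> * int d - int \<chi> * int n"
      using xi_chi_spec[of n d] False assms(2) by (auto simp: D_def)
    define q where "q = int \<xi> * ?x - int \<chi> * int m"
    obtain d' n' where dn: "d = d' * D" "n = n' * D"
      unfolding D_def by (metis dvd_div_mult_self gcd_dvd1 gcd_dvd2)
    have D: "D > 0" using False by (simp add: D_def)
    have quot: "d div D = d'" "n div D = n'"
      using dn D by (metis nonzero_mult_div_cancel_right less_numeral_extra(3))+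
    have "q * int n = int D * int m"
      unfolding q_def xc(2) using d by (simp add: algebra_simps)
    then have "(q * int n') * int D = int m * int D"
      using dn(2) by (simp add: algebra_simps)
    then have qn: "int n' * q = int m"
      using D by (simp add: mult.commute)
    have n': "n' \<ge> 1" using dn(2) assms(2) by (cases n') auto
    have q: "0 < q" using qn m n' by (metis of_nat_0_less_iff zero_less_mult_pos less_le_trans zero_less_one)
    have "int n' * q \<ge> q" using n' q by simp
    then have q_le: "q \<le> int m" using qn by simp
    have t: "eval (S m) v (D_term d n s) = q"
      using q q_le by (simp add: D_term_def xc(1) eval_seq_mult[OF v] q_def[symmetric])
    have "int n' * int D * ?x = int d' * int D * (int n' * q)"
      using d dn qn by (metis mult.commute of_nat_mult)
    then have "?x = int d' * q"
      using n' D by simp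
    moreover have "?x \<le> int m" using eval_S_range[OF v, of s] by simp
    ultimately have first: "?x = mv_mult (S m) d' q"
      using q by (simp add: mv_mult_S)
    have second: "int m - mv_mult (S m) k q = mv_mult (S m) (n' - k) q" if "k \<le> n'" for k
    proof -
      have "int k * q \<le> int n' * q" "int (n' - k) * q \<le> int n' * q"
        using that q by simp_all
      then show ?thesis
        using that q qn by (simp add: mv_mult_S of_nat_diff left_diff_distrib)
    qed
    show ?thesis
      using False first second
      by (auto simp: Fin_def Let_def D_def[symmetric] quot sat_S_Equiv[OF m v] eval_Mult t)
  qed
qed


section \<open>Identities of Komori varieties\<close>

context ranked_group
begin

lemma sat_Fin_disj:
  assumes "m dvd n" "n \<ge> 1" and v: "range v \<subseteq> {0..u}"
  shows "sat (Gamma u) v (Disj (map (\<lambda>d. Fin n d t) [0..<n + 1]))"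
proof -
  have "m \<le> n" using assms(1,2) by (auto simp: dvd_imp_le)
  obtain c where c: "n = m * c" using assms(1) by blast
  have w: "range (rank \<circ> v) \<subseteq> {0..int m}"
    using v rank_range by fastforce
  define d where "d = nat (eval (S m) (rank \<circ> v) t) * c"
  have x: "0 \<le> eval (S m) (rank \<circ> v) t" "eval (S m) (rank \<circ> v) t \<le> int m"
    using eval_S_range[OF w, of t] by simp_all
  then have "sat (S m) (rank \<circ> v) (Fin n d t)"
    using assms(1,2) by (intro sat_S_Fin w) (simp_all add: d_def c)
  moreover have "d \<le> n"
    unfolding d_def c using x by (intro mult_right_mono) auto
  ultimately show ?thesis
    using sat_rank[OF coarse_Fin v \<open>m \<le> n\<close>]
    unfolding sat.simps by (intro bexI[of _ "Fin n d t"]) (auto simp del: upt.simps)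
qed

lemma sat_Fin_rank:
  assumes "m \<le> n" "range v \<subseteq> {0..u}" "sat (Gamma u) v (Fin n d t)"
  shows "rank (eval (Gamma u) v t) = 0 \<longleftrightarrow> d = 0"
proof -
  have w: "range (rank \<circ> v) \<subseteq> {0..int m}"
    using assms(2) rank_range by fastforce
  have "sat (S m) (rank \<circ> v) (Fin n d t)"
    using assms(3) sat_rank[OF coarse_Fin assms(2,1)] by simp
  from sat_S_Fin_rank[OF m_pos assms(1) w this] show ?thesis
    by (simp add: eval_rank)
qed

end

text \<open>
  The rules \<open>idem\<close>, \<open>idem_Neg\<close> and \<open>Fin_disj\<close> serve to derive \<open>\<rho>\<^sub>n\<close> from locality,
  \<open>Fin_zero\<close> and \<open>Fin_pos\<close> to derive locality from \<open>\<rho>\<^sub>n\<close>.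
\<close>

inductive_set coarse_identities :: "nat \<Rightarrow> (mv_term \<times> mv_term) set" for n
  where
    idem: "(Oplus (appreciable n s) (appreciable n s), appreciable n s)
      \<in> coarse_identities n"
  | idem_Neg: "(Oplus (Neg (appreciable n s)) (Neg (appreciable n s)), Neg (appreciable n s))
      \<in> coarse_identities n"
  | Fin_disj: "(defect (Disj (map (\<lambda>d. Fin n d (Var 0)) [0..<n + 1])), Zero)
      \<in> coarse_identities n"
  | Fin_zero: "(Oplus (defect (Fin n 0 (Var 0))) (Mult (n + 1) (Neg (Var 0))), One)
      \<in> coarse_identities n"
  | Fin_pos: "d \<ge> 1 \<Longrightarrow> (Oplus (defect (Fin n d (Var 0))) (Mult (n + 1) (Var 0)), One)
      \<in> coarse_identities n"

lemma (in ranked_group) coarse_identities_Gamma: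
  assumes "m dvd n" "n \<ge> 1" "(l, r) \<in> coarse_identities n"
  shows "holds (Gamma u) (identity (l, r))"
proof -
  have mn: "m \<le> n" using assms(1,2) by (auto simp: dvd_imp_le)
  interpret T: two_valued "Gamma u" n
    using mn by (rule two_valued_Gamma)
  have "eval (Gamma u) v l = eval (Gamma u) v r" if v: "range v \<subseteq> {0..u}" for v
  proof -
    have v': "range v \<subseteq> carrier (Gamma u)" using v by simp
    note defect = T.defect_eq[OF coarse_Fin v'] T.defect_eq[OF coarse_Fins v']
    have x: "0 \<le> v 0" "v 0 \<le> u" using v by (auto simp: image_subset_iff)
    have mem: "mv_mult (Gamma u) (n + 1) (v 0) \<in> {0..u}"
      "mv_mult (Gamma u) (n + 1) (u - v 0) \<in> {0..u}"
      using G.eval_closed[OF v', of "Mult (n + 1) (Var 0)"]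
        G.eval_closed[OF v', of "Mult (n + 1) (Neg (Var 0))"]
      by (simp_all add: eval_Mult del: mv_mult.simps Mult.simps)
    have low: "mv_mult (Gamma u) (n + 1) (v 0) = u"
      if "sat (Gamma u) v (Fin n d (Var 0))" "d \<ge> 1" for d
      using sat_Fin_rank[OF mn v that(1)] that(2) x mn by (intro mult_eq_one) auto
    have high: "mv_mult (Gamma u) (n + 1) (u - v 0) = u"
      if "sat (Gamma u) v (Fin n 0 (Var 0))"
      using sat_Fin_rank[OF mn v that(1)] x mn m_pos
      by (intro mult_eq_one) (auto simp: rank_diff rank_unit)
    show ?thesis
      using assms(3)
    proof cases
      case (idem s)
      then show ?thesis
        using T.appreciable_cases[OF v', of s] unit_ge_zero by (auto simp: inf_absorb1 inf_absorb2)
    next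
      case (idem_Neg s)
      then show ?thesis
        using T.appreciable_cases[OF v', of s] unit_ge_zero by (auto simp: inf_absorb1 inf_absorb2)
    next
      case Fin_disj
      then show ?thesis
        using sat_Fin_disj[OF assms(1,2) v, of "Var 0"]
        by (simp only: defect if_True eval.simps)
    next
      case Fin_zero
      show ?thesis
        unfolding Fin_zero eval.simps defect eval_Mult eval_One Gamma_simps
        using high mem(2) unit_ge_zero by (auto simp: inf_absorb2 simp del: mv_mult.simps)
    next
      case (Fin_pos d)
      show ?thesis
        unfolding Fin_pos(1,2) eval.simps defect eval_Mult eval_One Gamma_simps
        using low[OF _ Fin_pos(3)] mem(1) unit_ge_zero
        by (auto simp: inf_absorb2 simp del: mv_mult.simps)
    qed
  qed
  then show ?thesis
    by (simp add: identity_def)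
qed

lemma coarse_identities_hold:
  assumes "A \<in> komori_variety I J" "\<forall>i \<in> I \<union> J. i \<ge> 1 \<and> i dvd n" "n \<ge> 1"
    and e: "(s, t) \<in> coarse_identities n" and v: "range v \<subseteq> carrier A"
  shows "eval A v s = eval A v t"
proof -
  have "holds (S i) (identity (s, t))" if "i \<in> I" for i
    using ranked_group.coarse_identities_Gamma[OF ranked_group_int _ assms(3) e, of i] assms(2) that
    by (simp add: S_def)
  moreover have "holds (S_omega j) (identity (s, t))" if "j \<in> J" for j
    using ranked_group.coarse_identities_Gamma[OF ranked_group_lex _ assms(3) e, of j] assms(2) that
    by (simp add: S_omega_def)
  ultimately have "identity (s, t) \<in> T_V I J"
    unfolding T_V_def by blast
  moreover have "models A (T_V I J)"
    using assms(1) by (simp add: models_T_V_iff)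
  ultimately show ?thesis
    using v by (auto simp: models_def identity_def)
qed


section \<open>Local algebras\<close>

text \<open>
  Multiples of an idempotent are equal to it, so locality applied to \<open>b\<close> makes \<open>b\<close> or \<open>\<not>b\<close>
  equal to \<open>1\<close>.
\<close>

lemma (in mv_algebra) local_idempotent:
  assumes "local_mv_algebra A" and b: "b \<in> carrier A" "b \<oplus> b = b" "\<sim> b \<oplus> \<sim> b = \<sim> b"
  shows "b = \<zero> \<or> b = \<one>"
proof -
  obtain k where "k \<ge> 1" "mv_mult A k b = \<one> \<or> mv_mult A k (\<sim> b) = \<one>"
    using assms(1) b(1) unfolding local_mv_algebra_def by blast
  then have "b = \<one> \<or> \<sim> b = \<one>"
    using mv_mult_idem[OF b(1,2)] mv_mult_idem[OF neg_closed[OF b(1)] b(3)] by (cases k) auto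
  then show ?thesis
    using neg_neg[OF b(1)] neg_one by metis
qed

lemma (in mv_algebra) carrier_trivial_iff: "carrier A = {\<zero>} \<longleftrightarrow> \<zero> = \<one>"
proof
  assume "\<zero> = \<one>"
  then have "x = \<zero>" if "x \<in> carrier A" for x
    using oplus_one(1)[OF that] oplus_zero[OF that] by simp
  then show "carrier A = {\<zero>}"
    using zero_closed by blast
qed (use one_closed in fastforce)

theorem mainTheorem9:
  fixes A :: "'a mv" and I J :: "nat set"
  assumes "finite I" and "finite J" and "I \<union> J \<noteq> {}"
    and "\<And>i. i \<in> I \<union> J \<Longrightarrow> i \<ge> 1"
    and "mv_algebra A" and "A \<in> komori_variety I J"
  shows "local_mv_algebra A \<longleftrightarrow> models A (Loc2 I J)"
proof -
  interpret mv_algebra A by fact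
  define n where "n = Lcm (I \<union> J)"
  have "0 \<notin> I \<union> J" using assms(4) by force
  then have "n \<noteq> 0"
    using assms(1,2) unfolding n_def by (subst Lcm_0_iff) auto
  then have n: "n \<ge> 1" by simp
  have "\<forall>i \<in> I \<union> J. i \<ge> 1 \<and> i dvd n"
    using assms(4) by (simp add: n_def)
  note ident = coarse_identities_hold[OF assms(6) this n]
  show ?thesis
  proof
    assume loc: "local_mv_algebra A"
    interpret two_valued A n
    proof
      show "\<zero>\<^bsub>A\<^esub> \<noteq> \<one>\<^bsub>A\<^esub>"
        using loc carrier_trivial_iff by (simp add: local_mv_algebra_def)
    next
      fix v :: "nat \<Rightarrow> 'a" and s
      assume v: "range v \<subseteq> carrier A"
      show "eval A v (appreciable n s) = \<zero>\<^bsub>A\<^esub> \<or> eval A v (appreciable n s) = \<one>\<^bsub>A\<^esub>"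
        using ident[OF idem v, of s] ident[OF idem_Neg v, of s]
        by (intro local_idempotent[OF loc] eval_closed[OF v]) simp_all
    qed
    have "sat A v (Disj (map (\<lambda>d. Fin n d (Var 0)) [0..<n + 1]))"
      if v: "range v \<subseteq> carrier A" for v :: "nat \<Rightarrow> 'a"
      using ident[OF Fin_disj v] defect_eq[OF coarse_Fins v, of "Var 0" "[0..<n + 1]"] nontrivial
      by (simp del: sat.simps defect.simps upt.simps split: if_splits)
    then have "holds A (rho n)"
      by (simp add: rho_def del: upt.simps)
    moreover have "holds A (Eq Zero One \<turnstile> Disj [])"
      using nontrivial by (simp add: eval_One)
    moreover have "models A (T_V I J)"
      using assms(6) by (simp add: models_T_V_iff)
    ultimately show "models A (Loc2 I J)"
      by (auto simp: models_def Loc2_def n_def)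
  next
    assume m: "models A (Loc2 I J)"
    then have rho: "holds A (rho n)" and "holds A (Eq Zero One \<turnstile> Disj [])"
      by (auto simp: models_def Loc2_def n_def)
    then have "\<zero>\<^bsub>A\<^esub> \<noteq> \<one>\<^bsub>A\<^esub>"
      using zero_closed by (auto simp: eval_One dest: spec[of _ "\<lambda>_. \<zero>\<^bsub>A\<^esub>"])
    moreover have "mv_mult A (n + 1) x = \<one>\<^bsub>A\<^esub> \<or> mv_mult A (n + 1) (\<sim>\<^bsub>A\<^esub> x) = \<one>\<^bsub>A\<^esub>"
      if x: "x \<in> carrier A" for x
    proof -
      define v where "v = (\<lambda>_::nat. x)"
      have v: "range v \<subseteq> carrier A" using x by (auto simp: v_def)
      then obtain d where d: "sat A v (Fin n d (Var 0))"
        using rho by (auto simp: rho_def simp del: upt.simps)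
      have zero: "eval A v (defect (Fin n d (Var 0))) = \<zero>\<^bsub>A\<^esub>"
        using coarse_Fin v d by (rule defect_eq_zero)
      define s where "s = (if d = 0 then Neg (Var 0) else Var 0)"
      have "eval A v (Oplus (defect (Fin n d (Var 0))) (Mult (n + 1) s)) = eval A v One"
        using ident[OF Fin_zero v] ident[OF Fin_pos v, of d] by (simp add: s_def del: Mult.simps)
      then have "eval A v (Mult (n + 1) s) = \<one>\<^bsub>A\<^esub>"
        using zero_oplus[OF eval_closed[OF v, of "Mult (n + 1) s"]] zero
        by (simp add: eval_One del: Mult.simps)
      then show ?thesis
        by (simp add: eval_Mult s_def v_def del: Mult.simps mv_mult.simps split: if_splits)
    qed
    ultimately show "local_mv_algebra A"
      unfolding local_mv_algebra_def
      using assms(5) carrier_trivial_iff by (metis le_add2)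
  qed
qed

end
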